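(* Let $\epsilon_2$ be the threshold of the stability property (S) in the context. There exists a constant $\epsilon_3\in(0,\epsilon_2)$ such that for any given $\epsilon\in(0,\epsilon_3)$ and any given $C^1$ smooth functions $\phi_{1_b}(t),\phi_{2_b}(t)$ satisfying $$\phi_{i_b}(t+T_* )=\phi_{i_b}(t)\quad(t>0,\ i=1,2),\qquad \|\phi_{i_b}\|_{C^1(\mathbb{R}_+)}\le\epsilon\quad(i=1,2),$$ the corresponding time-periodic solution $\phi=\phi^{(T_* )}(t,x)$ of the problem (IBVP), obtained through the existence property (E) in the context, is unique.
   Context: Setting. $\gamma>1$, $\underline\rho>0$, $L>0$, $T_*>0$, $\beta_*<0$ and $\kappa_1,\kappa_2$ with $|\kappa_1|<1$, $|\kappa_2|<1$ are constants; $D=\{(t,x):t\in\mathbb{R}_+,\ x\in[0,L]\}$. For $(m,n)\in\mathbb{R}^2$, $\lambda_1(m,n)=\frac{\gamma+1}{2}m+\frac{3-\gamma}{2}n$ and $\lambda_2(m,n)=\frac{3-\gamma}{2}m+\frac{\gamma+1}{2}n$. $\Phi=(\underline m,\underline n)^\top$ with $-\underline m=\underline n=\frac{\sqrt\gamma}{\gamma-1}\underline\rho^{\frac{\gamma-1}{2}}$, so that $\lambda_1(\Phi)<0<\lambda_2(\Phi)$; $\Psi$ is a small neighborhood of $0\in\mathbb{R}^2$ such that $\lambda_1(\phi+\Phi)<0<\lambda_2(\phi+\Phi)$ for all $\phi\in\Psi$. The damping coefficient $\beta=\beta(t,x)$ is a $C^2$ function on $D$ satisfying, with the same small constant $\epsilon$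 as in the statements, $$\beta_*\le\beta(t,x)\le0,\qquad |\partial_t\beta|,|\partial_x\beta|\le\epsilon,\qquad \beta(t+T_*,x)=\beta(t,x).$$ The $C^1$ norm is the maximum, over components, of the sup norms of the function and its first-order derivatives; $[s]$ is the integer part of $s$. (IBVP): for $\phi=(\phi_1,\phi_2)^\top$, $$\partial_t\phi_i+\lambda_i(\phi+\Phi)\partial_x\phi_i=\tfrac{\beta}{2}(\phi_1+\phi_2)\ \text{ on } D,\quad i=1,2,$$ $$\phi(0,x)=\phi_0(x),\qquad \phi_2(t,0)=\phi_{2_b}(t)+\kappa_2\phi_1(t,0),\qquad \phi_1(t,L)=\phi_{1_b}(t)+\kappa_1\phi_2(t,L)\quad(t\ge0).$$ (E) Existence property, which fixes $\epsilon_1$ and $C_E$: there exist a small enough constant $\epsilon_1>0$ and a constant $C_E>0$ such that for any $0<\epsilon<\epsilon_1$ and any $C^1$ functions $\phi_{i_b}$ $(i=1,2)$ with $\phi_{i_b}(t+T_* )=\phi_{i_b}(t)$ for $t>0$ and $\|\phi_{i_b}\|_{C^1(\mathbb{R}_+)}\le\epsilon$, there exists a $C^1$ function $\phi_0$ with $\|\phi_0\|_{C^1([0,L])}\le C_E\epsilon$ such that (IBVP) admits a $C^1$ solution $\phi^{(T_* )}$ on $D$ with $\phi^{(T_* )}(t+T_*,x)=\phi^{(T_* )}(t,x)$ on $D$ and $\|\phi^{(T_* )}\|_{C^1(D)}\le C_E\epsilon$. (S) Stability property, which fixes $\epsilon_2$, $C_S$ and $\xi$: there exist a small constant $\epsilon_2\in(0,\epsilon_1)$,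 a constant $C_S>0$ and a constant $\xi\in(0,1)$ such that for any $\epsilon\in(0,\epsilon_2)$, any $C^1$ functions $\phi_{i_b}$ as in (E) and any $C^1$ function $\phi_0$ with $\|\phi_0\|_{C^1([0,L])}\le C_E\epsilon$ (with certain compatibilities between $\phi_0$ and the boundary data), (IBVP) has a unique global $C^1$ classical solution $\phi$ on $D$, and $\|\phi(t,\cdot)-\phi^{(T_* )}(t,\cdot)\|_{C^0}\le C_S\epsilon\,\xi^{[t/T_0]}$ for all $t\ge0$, where $\phi^{(T_* )}$ is the time-periodic solution given by (E) for $\phi_{1_b},\phi_{2_b}$ and $T_0=\max_{i=1,2}\sup_{\phi\in\Psi}\frac{L}{|\lambda_i(\phi+\Phi)|}$. *)

theory Defs
  imports "HOL-Analysis.Analysis"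
begin

section \<open>Function spaces on closed domains\<close>

text \<open>
  All derivatives are taken within the domain, hence are one-sided at its boundary.  Norms take
  values in the extended reals, so that they are meaningful for unbounded functions.  The library
  norm \<open>infnorm\<close> is the maximum of the absolute values of the components (the absolute value
  for scalars).
\<close>

definition C0_norm :: "'a set \<Rightarrow> ('a \<Rightarrow> 'b::euclidean_space) \<Rightarrow> ereal" where
  "C0_norm S f = (SUP p\<in>S. ereal (infnorm (f p)))"

definition C1_on :: "real set \<Rightarrow> (real \<Rightarrow> 'b::euclidean_space) \<Rightarrow> bool" where
  "C1_on I f \<longleftrightarrow>
     f differentiable_on I \<and> continuous_on I (\<lambda>t. vector_derivative f (at t within I))"

definition C1_norm :: "real set \<Rightarrow> (real \<Rightarrow> 'b::euclidean_space) \<Rightarrow> ereal" where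
  "C1_norm I f = max (C0_norm I f) (C0_norm I (\<lambda>t. vector_derivative f (at t within I)))"

definition Dom :: "real \<Rightarrow> (real \<times> real) set" where
  "Dom L = {0..} \<times> {0..L}"

definition dt :: "(real \<times> real \<Rightarrow> 'b::euclidean_space) \<Rightarrow> real \<times> real \<Rightarrow> 'b" where
  "dt f = (\<lambda>(t, x). vector_derivative (\<lambda>s. f (s, x)) (at t within {0..}))"

definition dx :: "real \<Rightarrow> (real \<times> real \<Rightarrow> 'b::euclidean_space) \<Rightarrow> real \<times> real \<Rightarrow> 'b" where
  "dx L f = (\<lambda>(t, x). vector_derivative (\<lambda>y. f (t, y)) (at x within {0..L}))"

definition C1_Dom :: "real \<Rightarrow> (real \<times> real \<Rightarrow> 'b::euclidean_space) \<Rightarrow> bool" where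
  "C1_Dom L f \<longleftrightarrow>
     (\<forall>x\<in>{0..L}. (\<lambda>s. f (s, x)) differentiable_on {0..}) \<and>
     (\<forall>t\<in>{0..}. (\<lambda>y. f (t, y)) differentiable_on {0..L}) \<and>
     continuous_on (Dom L) f \<and>
     continuous_on (Dom L) (dt f) \<and>
     continuous_on (Dom L) (dx L f)"

definition C2_Dom :: "real \<Rightarrow> (real \<times> real \<Rightarrow> 'b::euclidean_space) \<Rightarrow> bool" where
  "C2_Dom L f \<longleftrightarrow> C1_Dom L f \<and> C1_Dom L (dt f) \<and> C1_Dom L (dx L f)"

definition C1_norm_Dom :: "real \<Rightarrow> (real \<times> real \<Rightarrow> 'b::euclidean_space) \<Rightarrow> ereal" where
  "C1_norm_Dom L f =
     max (C0_norm (Dom L) f) (max (C0_norm (Dom L) (dt f)) (C0_norm (Dom L) (dx L f)))"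


section \<open>The initial-boundary value problem\<close>

definition char_speed :: "real \<Rightarrow> 2 \<Rightarrow> real^2 \<Rightarrow> real" where
  "char_speed \<gamma> i v =
     (if i = 1 then (\<gamma> + 1) / 2 * v$1 + (3 - \<gamma>) / 2 * v$2
      else (3 - \<gamma>) / 2 * v$1 + (\<gamma> + 1) / 2 * v$2)"

definition background :: "real \<Rightarrow> real \<Rightarrow> real^2" where
  "background \<gamma> \<rho> =
     (let n = sqrt \<gamma> / (\<gamma> - 1) * \<rho> powr ((\<gamma> - 1) / 2) in vector [- n, n])"

definition damping_coefficient ::
    "real \<Rightarrow> real \<Rightarrow> real \<Rightarrow> real \<Rightarrow> (real \<times> real \<Rightarrow> real) \<Rightarrow> bool" where
  "damping_coefficient L T \<beta>min \<epsilon> \<beta> \<longleftrightarrow>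
     C2_Dom L \<beta> \<and>
     (\<forall>(t, x)\<in>Dom L.
        \<beta>min \<le> \<beta> (t, x) \<and> \<beta> (t, x) \<le> 0 \<and>
        \<bar>dt \<beta> (t, x)\<bar> \<le> \<epsilon> \<and> \<bar>dx L \<beta> (t, x)\<bar> \<le> \<epsilon> \<and>
        \<beta> (t + T, x) = \<beta> (t, x))"

definition boundary_datum :: "real \<Rightarrow> real \<Rightarrow> (real \<Rightarrow> real) \<Rightarrow> bool" where
  "boundary_datum T \<epsilon> g \<longleftrightarrow>
     C1_on {0..} g \<and> (\<forall>t>0. g (t + T) = g t) \<and> C1_norm {0..} g \<le> ereal \<epsilon>"

definition ibvp_solution ::
    "real \<Rightarrow> real \<Rightarrow> real \<Rightarrow> real \<Rightarrow> real \<Rightarrow> (real \<times> real \<Rightarrow> real) \<Rightarrow>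
     (real \<Rightarrow> real) \<Rightarrow> (real \<Rightarrow> real) \<Rightarrow> (real \<Rightarrow> real^2) \<Rightarrow> (real \<times> real \<Rightarrow> real^2) \<Rightarrow> bool" where
  "ibvp_solution \<gamma> \<rho> L \<kappa>1 \<kappa>2 \<beta> \<phi>1b \<phi>2b \<phi>0 \<phi> \<longleftrightarrow>
     C1_Dom L \<phi> \<and>
     (\<forall>p\<in>Dom L. \<forall>i.
        dt \<phi> p $ i + char_speed \<gamma> i (\<phi> p + background \<gamma> \<rho>) * (dx L \<phi> p $ i)
          = \<beta> p / 2 * (\<phi> p $ 1 + \<phi> p $ 2)) \<and>
     (\<forall>x\<in>{0..L}. \<phi> (0, x) = \<phi>0 x) \<and>
     (\<forall>t\<ge>0. \<phi> (t, 0) $ 2 = \<phi>2b t + \<kappa>2 * (\<phi> (t, 0) $ 1)) \<and>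
     (\<forall>t\<ge>0. \<phi> (t, L) $ 1 = \<phi>1b t + \<kappa>1 * (\<phi> (t, L) $ 2))"

text \<open>
  The time derivative at time \<open>0\<close> that the equations prescribe for initial data \<open>\<phi>0\<close>.
\<close>

definition initial_dt ::
    "real \<Rightarrow> real \<Rightarrow> real \<Rightarrow> (real \<times> real \<Rightarrow> real) \<Rightarrow> (real \<Rightarrow> real^2) \<Rightarrow> real \<Rightarrow> 2 \<Rightarrow> real" where
  "initial_dt \<gamma> \<rho> L \<beta> \<phi>0 x i =
     \<beta> (0, x) / 2 * (\<phi>0 x $ 1 + \<phi>0 x $ 2)
       - char_speed \<gamma> i (\<phi>0 x + background \<gamma> \<rho>) *
         (vector_derivative \<phi>0 (at x within {0..L}) $ i)"

text \<open>
  The compatibility conditions of orders 0 and 1 at the corners \<open>(0,0)\<close> and \<open>(0,L)\<close>, i.e. the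
  boundary conditions and their first time derivatives evaluated at \<open>t = 0\<close>.  Every \<open>C\<^sup>1\<close>
  solution up to the boundary has initial data satisfying them.
\<close>

definition compatible ::
    "real \<Rightarrow> real \<Rightarrow> real \<Rightarrow> real \<Rightarrow> real \<Rightarrow> (real \<times> real \<Rightarrow> real) \<Rightarrow>
     (real \<Rightarrow> real) \<Rightarrow> (real \<Rightarrow> real) \<Rightarrow> (real \<Rightarrow> real^2) \<Rightarrow> bool" where
  "compatible \<gamma> \<rho> L \<kappa>1 \<kappa>2 \<beta> \<phi>1b \<phi>2b \<phi>0 \<longleftrightarrow>
     \<phi>0 0 $ 2 = \<phi>2b 0 + \<kappa>2 * (\<phi>0 0 $ 1) \<and>
     \<phi>0 L $ 1 = \<phi>1b 0 + \<kappa>1 * (\<phi>0 L $ 2) \<and>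
     initial_dt \<gamma> \<rho> L \<beta> \<phi>0 0 2
       = vector_derivative \<phi>2b (at 0 within {0..}) + \<kappa>2 * initial_dt \<gamma> \<rho> L \<beta> \<phi>0 0 1 \<and>
     initial_dt \<gamma> \<rho> L \<beta> \<phi>0 L 1
       = vector_derivative \<phi>1b (at 0 within {0..}) + \<kappa>1 * initial_dt \<gamma> \<rho> L \<beta> \<phi>0 L 2"


section \<open>Time-periodic solutions: existence and stability properties\<close>

text \<open>The time-periodic solutions provided by the existence property.\<close>

definition periodic_solution ::
    "real \<Rightarrow> real \<Rightarrow> real \<Rightarrow> real \<Rightarrow> real \<Rightarrow> real \<Rightarrow> real \<Rightarrow> real \<Rightarrow> (real \<times> real \<Rightarrow> real) \<Rightarrow>
     (real \<Rightarrow> real) \<Rightarrow> (real \<Rightarrow> real) \<Rightarrow> (real \<times> real \<Rightarrow> real^2) \<Rightarrow> bool" where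
  "periodic_solution \<gamma> \<rho> L T \<kappa>1 \<kappa>2 CE \<epsilon> \<beta> \<phi>1b \<phi>2b \<phi> \<longleftrightarrow>
     (\<exists>\<phi>0. C1_on {0..L} \<phi>0 \<and> C1_norm {0..L} \<phi>0 \<le> ereal (CE * \<epsilon>) \<and>
        ibvp_solution \<gamma> \<rho> L \<kappa>1 \<kappa>2 \<beta> \<phi>1b \<phi>2b \<phi>0 \<phi>) \<and>
     (\<forall>(t, x)\<in>Dom L. \<phi> (t + T, x) = \<phi> (t, x)) \<and>
     C1_norm_Dom L \<phi> \<le> ereal (CE * \<epsilon>)"

text \<open>
  The bound on the derivatives of the damping coefficient involves \<open>\<epsilon>\<close>, so \<open>\<beta>\<close> is quantified
  after \<open>\<epsilon>\<close>, and the constants are uniform in \<open>\<beta>\<close>.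
\<close>

definition existence_property ::
    "real \<Rightarrow> real \<Rightarrow> real \<Rightarrow> real \<Rightarrow> real \<Rightarrow> real \<Rightarrow> real \<Rightarrow> real \<Rightarrow> real \<Rightarrow> bool" where
  "existence_property \<gamma> \<rho> L T \<beta>min \<kappa>1 \<kappa>2 \<epsilon>1 CE \<longleftrightarrow>
     0 < \<epsilon>1 \<and> 0 < CE \<and>
     (\<forall>\<epsilon> \<beta> \<phi>1b \<phi>2b.
        0 < \<epsilon> \<and> \<epsilon> < \<epsilon>1 \<and> damping_coefficient L T \<beta>min \<epsilon> \<beta> \<and>
        boundary_datum T \<epsilon> \<phi>1b \<and> boundary_datum T \<epsilon> \<phi>2b \<longrightarrow>
        (\<exists>\<phi>. periodic_solution \<gamma> \<rho> L T \<kappa>1 \<kappa>2 CE \<epsilon> \<beta> \<phi>1b \<phi>2b \<phi>))"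

text \<open>
  Meaningful only if both suprema are finite; this is part of \<open>admissible_nbhd\<close>.
\<close>

definition T0 :: "real \<Rightarrow> real \<Rightarrow> real \<Rightarrow> (real^2) set \<Rightarrow> real" where
  "T0 \<gamma> \<rho> L \<Psi> =
     max (SUP \<psi>\<in>\<Psi>. L / \<bar>char_speed \<gamma> 1 (\<psi> + background \<gamma> \<rho>)\<bar>)
         (SUP \<psi>\<in>\<Psi>. L / \<bar>char_speed \<gamma> 2 (\<psi> + background \<gamma> \<rho>)\<bar>)"

definition admissible_nbhd :: "real \<Rightarrow> real \<Rightarrow> real \<Rightarrow> (real^2) set \<Rightarrow> bool" where
  "admissible_nbhd \<gamma> \<rho> L \<Psi> \<longleftrightarrow>
     0 \<in> interior \<Psi> \<and>
     (\<forall>\<psi>\<in>\<Psi>. char_speed \<gamma> 1 (\<psi> + background \<gamma> \<rho>) < 0 \<and>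
             0 < char_speed \<gamma> 2 (\<psi> + background \<gamma> \<rho>)) \<and>
     (\<forall>i. bdd_above ((\<lambda>\<psi>. L / \<bar>char_speed \<gamma> i (\<psi> + background \<gamma> \<rho>)\<bar>) ` \<Psi>))"

text \<open>
  In the following, \<open>\<phi>T\<close> is a time-periodic solution given by the existence property.  It depends
  on \<open>\<epsilon>\<close>, \<open>\<beta>\<close> and the boundary data, but not on the initial data \<open>\<phi>0\<close>.  Stability is
  required for one such solution only, as its uniqueness is not presupposed.
\<close>

definition stability_property ::
    "real \<Rightarrow> real \<Rightarrow> real \<Rightarrow> real \<Rightarrow> real \<Rightarrow> real \<Rightarrow> real \<Rightarrow> (real^2) set \<Rightarrow> real \<Rightarrow> real \<Rightarrow>
     real \<Rightarrow> real \<Rightarrow> real \<Rightarrow> bool" where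
  "stability_property \<gamma> \<rho> L T \<beta>min \<kappa>1 \<kappa>2 \<Psi> \<epsilon>1 CE \<epsilon>2 CS \<xi> \<longleftrightarrow>
     0 < \<epsilon>2 \<and> \<epsilon>2 < \<epsilon>1 \<and> 0 < CS \<and> 0 < \<xi> \<and> \<xi> < 1 \<and>
     (\<forall>\<epsilon> \<beta> \<phi>1b \<phi>2b.
        0 < \<epsilon> \<and> \<epsilon> < \<epsilon>2 \<and> damping_coefficient L T \<beta>min \<epsilon> \<beta> \<and>
        boundary_datum T \<epsilon> \<phi>1b \<and> boundary_datum T \<epsilon> \<phi>2b \<longrightarrow>
        (\<exists>\<phi>T. periodic_solution \<gamma> \<rho> L T \<kappa>1 \<kappa>2 CE \<epsilon> \<beta> \<phi>1b \<phi>2b \<phi>T \<and>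
           (\<forall>\<phi>0. C1_on {0..L} \<phi>0 \<and> C1_norm {0..L} \<phi>0 \<le> ereal (CE * \<epsilon>) \<and>
                 compatible \<gamma> \<rho> L \<kappa>1 \<kappa>2 \<beta> \<phi>1b \<phi>2b \<phi>0 \<longrightarrow>
              (\<exists>\<phi>. ibvp_solution \<gamma> \<rho> L \<kappa>1 \<kappa>2 \<beta> \<phi>1b \<phi>2b \<phi>0 \<phi> \<and>
                 (\<forall>\<psi>. ibvp_solution \<gamma> \<rho> L \<kappa>1 \<kappa>2 \<beta> \<phi>1b \<phi>2b \<phi>0 \<psi> \<longrightarrow>
                      (\<forall>p\<in>Dom L. \<psi> p = \<phi> p)) \<and>
                 (\<forall>t\<ge>0. C0_norm {0..L} (\<lambda>x. \<phi> (t, x) - \<phi>T (t, x))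
                           \<le> ereal (CS * \<epsilon> * \<xi> ^ nat \<lfloor>t / T0 \<gamma> \<rho> L \<Psi>\<rfloor>))))))"

end

theory Submission
  imports Defs
begin

text \<open>
  The initial data of any \<open>C\<^sup>1\<close> time-periodic solution \<open>\<psi>\<close> are small and satisfy the
  compatibility conditions, so stability applies to them: \<open>\<psi>\<close> is the solution with these data
  and converges to the periodic solution \<open>\<phi>\<^sup>T\<close> as time grows.  The difference
  of the two is periodic in time and tends to zero, hence vanishes.
\<close>

text \<open>\<open>vector_derivative\<close> is a choice among all derivatives within S. Functions
  agreeing on S have the same derivatives there, so the choices coincide even when no derivative
  exists.\<close>

lemma vector_derivative_within_cong:
  fixes f g :: "real \<Rightarrow> 'a::real_normed_vector"
  assumes "x \<in> S" and "\<And>y. y \<in> S \<Longrightarrow> f y = g y"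
  shows "vector_derivative f (at x within S) = vector_derivative g (at x within S)"
proof -
  have "(f has_vector_derivative D) (at x within S) \<longleftrightarrow>
        (g has_vector_derivative D) (at x within S)" for D
    using has_vector_derivative_transform[of x S f g D] has_vector_derivative_transform[of x S g f D]
      assms by auto
  then show ?thesis
    by (simp add: vector_derivative_def)
qed

lemma has_vector_derivative_vec_nth:
  fixes f :: "real \<Rightarrow> real^'n"
  assumes "(f has_vector_derivative D) F"
  shows "((\<lambda>t. f t $ i) has_vector_derivative D $ i) F"
  using bounded_linear.has_vector_derivative[OF bounded_linear_vec_nth assms] .

lemma C1_Dom_dt:
  assumes "C1_Dom L \<phi>" and "x \<in> {0..L}" and "t \<ge> 0"
  shows "((\<lambda>s. \<phi> (s, x)) has_vector_derivative dt \<phi> (t, x)) (at t within {0..})"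
  using assms
  by (simp add: C1_Dom_def dt_def differentiable_on_def vector_derivative_works)

text \<open>The right-hand limit filter at t is nontrivial and lies below this one. It serves to
  make one-sided time derivatives at the initial time unique.\<close>

lemma at_within_atLeast_nontrivial: "at t within {t..} \<noteq> bot" for t :: real
  using at_le[of "{t<..}" "{t..}" t] trivial_limit_at_right_real[of t] bot.extremum_uniqueI
  by fastforce

text \<open>Order 0 is the boundary conditions read at t = 0. Order 1 is their time derivative at t
  = 0, with the time derivatives of the solution expressed through the equations. This supplies the
  compatibility premise of stability, which \<open>periodic_solution\<close> does not state.\<close>

lemma ibvp_solution_compatible:
  assumes sol: "ibvp_solution \<gamma> \<rho> L \<kappa>1 \<kappa>2 \<beta> \<phi>1b \<phi>2b \<phi>0 \<phi>" and "L > 0"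
    and "C1_on {0..} \<phi>1b" and "C1_on {0..} \<phi>2b"
  shows "compatible \<gamma> \<rho> L \<kappa>1 \<kappa>2 \<beta> \<phi>1b \<phi>2b \<phi>0"
proof -
  have C1: "C1_Dom L \<phi>"
    and init: "\<And>x. x \<in> {0..L} \<Longrightarrow> \<phi> (0, x) = \<phi>0 x"
    and bc2: "\<And>t. t \<ge> 0 \<Longrightarrow> \<phi> (t, 0) $ 2 = \<phi>2b t + \<kappa>2 * (\<phi> (t, 0) $ 1)"
    and bc1: "\<And>t. t \<ge> 0 \<Longrightarrow> \<phi> (t, L) $ 1 = \<phi>1b t + \<kappa>1 * (\<phi> (t, L) $ 2)"
    using sol by (auto simp: ibvp_solution_def)
  \<comment> \<open>The equation at time 0, solved for the time derivative; the space derivative is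
    that of \<open>\<phi>0\<close> because the initial condition holds on all of [0,L].\<close>
  have dt_init: "dt \<phi> (0, x) $ i = initial_dt \<gamma> \<rho> L \<beta> \<phi>0 x i" if x: "x \<in> {0..L}" for x i
  proof -
    have "dx L \<phi> (0, x) = vector_derivative \<phi>0 (at x within {0..L})"
      using vector_derivative_within_cong[OF x, of "\<lambda>y. \<phi> (0, y)" \<phi>0] init
      by (simp add: dx_def)
    moreover have "(0, x) \<in> Dom L"
      using x by (simp add: Dom_def)
    then have "dt \<phi> (0, x) $ i + char_speed \<gamma> i (\<phi> (0, x) + background \<gamma> \<rho>) * (dx L \<phi> (0, x) $ i)
        = \<beta> (0, x) / 2 * (\<phi> (0, x) $ 1 + \<phi> (0, x) $ 2)"
      using sol by (auto simp: ibvp_solution_def)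
    ultimately show ?thesis
      using init[OF x] by (simp add: initial_dt_def algebra_simps)
  qed
  \<comment> \<open>Both ends at once: (i, j) is (2, 1) at x = 0 and (1, 2) at x = L. Both sides are
    right derivatives at 0 of component i along the boundary, hence equal.\<close>
  have order1: "dt \<phi> (0, x) $ i = vector_derivative b (at 0 within {0..}) + \<kappa> * (dt \<phi> (0, x) $ j)"
    if x: "x \<in> {0..L}" and b: "C1_on {0..} b"
      and bc: "\<And>t. t \<ge> 0 \<Longrightarrow> \<phi> (t, x) $ i = b t + \<kappa> * (\<phi> (t, x) $ j)"
    for x b \<kappa> and i j :: 2
  proof (rule vector_derivative_unique_within[OF at_within_atLeast_nontrivial])
    have D: "((\<lambda>t. \<phi> (t, x) $ k) has_vector_derivative dt \<phi> (0, x) $ k) (at 0 within {0..})" for k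
      using has_vector_derivative_vec_nth[OF C1_Dom_dt[OF C1 x]] by simp
    then show "((\<lambda>t. \<phi> (t, x) $ i) has_vector_derivative dt \<phi> (0, x) $ i) (at 0 within {0..})" .
    have "(b has_vector_derivative vector_derivative b (at 0 within {0..})) (at 0 within {0..})"
      using b by (simp add: C1_on_def differentiable_on_def vector_derivative_works)
    then have "((\<lambda>t. b t + \<kappa> * (\<phi> (t, x) $ j)) has_vector_derivative
        vector_derivative b (at 0 within {0..}) + \<kappa> * (dt \<phi> (0, x) $ j)) (at 0 within {0..})"
      by (intro has_vector_derivative_add has_vector_derivative_mult_right D)
    then show "((\<lambda>t. \<phi> (t, x) $ i) has_vector_derivative
        vector_derivative b (at 0 within {0..}) + \<kappa> * (dt \<phi> (0, x) $ j)) (at 0 within {0..})"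
      by (rule has_vector_derivative_transform[rotated 2]) (use bc in auto)
  qed
  have ends: "0 \<in> {0..L}" "L \<in> {0..L}"
    using \<open>L > 0\<close> by auto
  show ?thesis
    unfolding compatible_def
    using bc1[of 0] bc2[of 0] init[OF ends(1)] init[OF ends(2)]
      order1[OF ends(1) assms(4) bc2] order1[OF ends(2) assms(3) bc1]
    by (simp add: dt_init ends \<open>L > 0\<close>[THEN less_imp_le])
qed

text \<open>The first supremum dominates its value at \<open>\<psi> = 0\<close>, the crossing time
  of the first characteristic family at the background state, which is positive since the speed
  there is negative. Positivity makes the decay exponent grow with time.\<close>

lemma T0_pos:
  assumes "admissible_nbhd \<gamma> \<rho> L \<Psi>" and "L > 0"
  shows "T0 \<gamma> \<rho> L \<Psi> > 0"
proof -
  let ?f = "\<lambda>\<psi>. L / \<bar>char_speed \<gamma> 1 (\<psi> + background \<gamma> \<rho>)\<bar>"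
  have "0 \<in> \<Psi>"
    using assms(1) interior_subset by (auto simp: admissible_nbhd_def)
  then have "char_speed \<gamma> 1 (0 + background \<gamma> \<rho>) < 0"
    using assms(1) unfolding admissible_nbhd_def by blast
  then have "0 < ?f 0"
    using \<open>L > 0\<close> by (intro divide_pos_pos) auto
  \<comment> \<open>A real supremum dominates its members only when the set is bounded
    above.\<close>
  moreover have "bdd_above (?f ` \<Psi>)"
    using assms(1) by (simp add: admissible_nbhd_def)
  then have "?f 0 \<le> (SUP \<psi>\<in>\<Psi>. ?f \<psi>)"
    using cSUP_upper[OF \<open>0 \<in> \<Psi>\<close>, of ?f] by blast
  ultimately have "0 < (SUP \<psi>\<in>\<Psi>. ?f \<psi>)"
    by (rule less_le_trans)
  then show ?thesis
    by (simp add: T0_def less_max_iff_disj)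
qed

lemma periodic_add_of_nat_mult:
  fixes T :: real
  assumes per: "\<forall>(t, x)\<in>Dom L. \<phi> (t + T, x) = \<phi> (t, x)" and "T \<ge> 0"
    and "(t, x) \<in> Dom L"
  shows "\<phi> (t + real n * T, x) = \<phi> (t, x)"
proof (induction n)
  case (Suc n)
  have "(t + real n * T, x) \<in> Dom L"
    using assms by (auto simp: Dom_def)
  then show ?case
    using per Suc by (force simp: algebra_simps)
qed simp

text \<open>The value at t recurs at every time t + n T, while the bound at those times tends to 0
  as n grows.\<close>

lemma periodic_decay_imp_zero:
  fixes f :: "real \<Rightarrow> 'a::euclidean_space"
  assumes "T > 0" and "\<tau> > 0" and "0 < \<xi>" and "\<xi> < 1"
    and per: "\<And>n. f (t + real n * T) = f t"
    and decay: "\<And>n. infnorm (f (t + real n * T)) \<le> C * \<xi> ^ nat \<lfloor>(t + real n * T) / \<tau>\<rfloor>"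
  shows "f t = 0"
proof -
  \<comment> \<open>The exponent before rounding is affine in n with positive slope
    \<open>T / \<tau>\<close>; taking the integer part preserves divergence.\<close>
  have "filterlim (\<lambda>n. t / \<tau> + T / \<tau> * real n) at_top sequentially"
    using assms(1,2)
    by (intro filterlim_tendsto_add_at_top[OF tendsto_const]
        filterlim_tendsto_pos_mult_at_top[OF tendsto_const] filterlim_real_sequentially) simp
  then have "filterlim (\<lambda>n. nat \<lfloor>(t + real n * T) / \<tau>\<rfloor>) sequentially sequentially"
    by (intro filterlim_compose[OF filterlim_nat_sequentially]
        filterlim_compose[OF filterlim_floor_sequentially]) (simp add: add_divide_distrib mult.commute)
  then have "(\<lambda>n. \<xi> ^ nat \<lfloor>(t + real n * T) / \<tau>\<rfloor>) \<longlonglongrightarrow> 0"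
    using assms(3,4)
    by (intro filterlim_compose[OF LIMSEQ_power_zero]) auto
  then have "(\<lambda>n. C * \<xi> ^ nat \<lfloor>(t + real n * T) / \<tau>\<rfloor>) \<longlonglongrightarrow> 0"
    by (rule tendsto_mult_right_zero)
  \<comment> \<open>By periodicity the left side of the decay bound is constant in n, so it is at
    most the limit of the right side.\<close>
  then have "infnorm (f t) \<le> 0"
    using decay per by (intro LIMSEQ_le_const) auto
  then show ?thesis
    using infnorm_pos_le[of "f t"] infnorm_eq_0[of "f t"] by linarith
qed

theorem corollary2p1:
  fixes \<gamma> \<rho> L T \<beta>min \<kappa>1 \<kappa>2 \<epsilon>1 CE \<epsilon>2 CS \<xi> :: real
    and \<Psi> :: "(real^2) set"
  assumes "\<gamma> > 1" and "\<rho> > 0" and "L > 0" and "T > 0" and "\<beta>min < 0"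
    and "\<bar>\<kappa>1\<bar> < 1" and "\<bar>\<kappa>2\<bar> < 1"
    and "admissible_nbhd \<gamma> \<rho> L \<Psi>"
    and "existence_property \<gamma> \<rho> L T \<beta>min \<kappa>1 \<kappa>2 \<epsilon>1 CE"
    and "stability_property \<gamma> \<rho> L T \<beta>min \<kappa>1 \<kappa>2 \<Psi> \<epsilon>1 CE \<epsilon>2 CS \<xi>"
  shows "\<exists>\<epsilon>3. 0 < \<epsilon>3 \<and> \<epsilon>3 < \<epsilon>2 \<and>
    (\<forall>\<epsilon> \<beta> \<phi>1b \<phi>2b.
       0 < \<epsilon> \<and> \<epsilon> < \<epsilon>3 \<and> damping_coefficient L T \<beta>min \<epsilon> \<beta> \<and>
       boundary_datum T \<epsilon> \<phi>1b \<and> boundary_datum T \<epsilon> \<phi>2b \<longrightarrow>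
       (\<exists>\<phi>. periodic_solution \<gamma> \<rho> L T \<kappa>1 \<kappa>2 CE \<epsilon> \<beta> \<phi>1b \<phi>2b \<phi> \<and>
          (\<forall>\<psi>. periodic_solution \<gamma> \<rho> L T \<kappa>1 \<kappa>2 CE \<epsilon> \<beta> \<phi>1b \<phi>2b \<psi> \<longrightarrow>
               (\<forall>p\<in>Dom L. \<psi> p = \<phi> p))))"
proof -
  have \<tau>: "T0 \<gamma> \<rho> L \<Psi> > 0"
    using T0_pos assms by blast
  have \<epsilon>2: "0 < \<epsilon>2" and \<xi>: "0 < \<xi>" "\<xi> < 1"
    using assms(10) unfolding stability_property_def by blast+
  show ?thesis
  \<comment> \<open>Stability already covers every \<open>\<epsilon> < \<epsilon>2\<close>; halving
    only secures the strict inequality \<open>\<epsilon>3 < \<epsilon>2\<close>.\<close>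
  proof (intro exI[of _ "\<epsilon>2 / 2"] conjI allI impI)
    fix \<epsilon> \<beta> \<phi>1b \<phi>2b
    assume data: "0 < \<epsilon> \<and> \<epsilon> < \<epsilon>2 / 2 \<and> damping_coefficient L T \<beta>min \<epsilon> \<beta> \<and>
      boundary_datum T \<epsilon> \<phi>1b \<and> boundary_datum T \<epsilon> \<phi>2b"
    then have "0 < \<epsilon> \<and> \<epsilon> < \<epsilon>2 \<and> damping_coefficient L T \<beta>min \<epsilon> \<beta> \<and>
      boundary_datum T \<epsilon> \<phi>1b \<and> boundary_datum T \<epsilon> \<phi>2b"
      by linarith
    \<comment> \<open>\<open>\<phi>T\<close> is fixed before the initial data, so all periodic
      solutions are compared with the same limit.\<close>
    then obtain \<phi>T where \<phi>T: "periodic_solution \<gamma> \<rho> L T \<kappa>1 \<kappa>2 CE \<epsilon> \<beta> \<phi>1b \<phi>2b \<phi>T"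
      and stable: "\<forall>\<phi>0. C1_on {0..L} \<phi>0 \<and> C1_norm {0..L} \<phi>0 \<le> ereal (CE * \<epsilon>) \<and>
          compatible \<gamma> \<rho> L \<kappa>1 \<kappa>2 \<beta> \<phi>1b \<phi>2b \<phi>0 \<longrightarrow>
        (\<exists>\<phi>. ibvp_solution \<gamma> \<rho> L \<kappa>1 \<kappa>2 \<beta> \<phi>1b \<phi>2b \<phi>0 \<phi> \<and>
          (\<forall>\<psi>. ibvp_solution \<gamma> \<rho> L \<kappa>1 \<kappa>2 \<beta> \<phi>1b \<phi>2b \<phi>0 \<psi> \<longrightarrow> (\<forall>p\<in>Dom L. \<psi> p = \<phi> p)) \<and>
          (\<forall>t\<ge>0. C0_norm {0..L} (\<lambda>x. \<phi> (t, x) - \<phi>T (t, x))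
            \<le> ereal (CS * \<epsilon> * \<xi> ^ nat \<lfloor>t / T0 \<gamma> \<rho> L \<Psi>\<rfloor>)))"
      using assms(10)[unfolded stability_property_def, THEN conjunct2, THEN conjunct2,
          THEN conjunct2, THEN conjunct2, THEN conjunct2, THEN spec, THEN spec, THEN spec,
          THEN spec, THEN mp]
      by blast
    have "\<psi> p = \<phi>T p"
      if \<psi>: "periodic_solution \<gamma> \<rho> L T \<kappa>1 \<kappa>2 CE \<epsilon> \<beta> \<phi>1b \<phi>2b \<psi>" and p: "p \<in> Dom L" for \<psi> p
    proof -
      obtain \<psi>0 where \<psi>0: "C1_on {0..L} \<psi>0" "C1_norm {0..L} \<psi>0 \<le> ereal (CE * \<epsilon>)"
        and sol: "ibvp_solution \<gamma> \<rho> L \<kappa>1 \<kappa>2 \<beta> \<phi>1b \<phi>2b \<psi>0 \<psi>"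
        using \<psi> unfolding periodic_solution_def by blast
      have "compatible \<gamma> \<rho> L \<kappa>1 \<kappa>2 \<beta> \<phi>1b \<phi>2b \<psi>0"
        using ibvp_solution_compatible[OF sol] data assms(3) by (simp add: boundary_datum_def)
      \<comment> \<open>The uniqueness clause of stability identifies \<open>\<psi>\<close> with the
        solution \<open>\<phi>\<close> that carries the decay estimate.\<close>
      then obtain \<phi> where eq: "\<And>q. q \<in> Dom L \<Longrightarrow> \<psi> q = \<phi> q"
        and decay: "\<And>t. t \<ge> 0 \<Longrightarrow> C0_norm {0..L} (\<lambda>x. \<phi> (t, x) - \<phi>T (t, x))
            \<le> ereal (CS * \<epsilon> * \<xi> ^ nat \<lfloor>t / T0 \<gamma> \<rho> L \<Psi>\<rfloor>)"
        using stable[THEN spec, of \<psi>0] \<psi>0 sol by blast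
      obtain t x where tx: "p = (t, x)" "t \<ge> 0" "x \<in> {0..L}"
        using p by (auto simp: Dom_def)
      have \<psi>_per: "\<forall>(t, x)\<in>Dom L. \<psi> (t + T, x) = \<psi> (t, x)"
        and \<phi>T_per: "\<forall>(t, x)\<in>Dom L. \<phi>T (t + T, x) = \<phi>T (t, x)"
        using \<psi> \<phi>T unfolding periodic_solution_def by blast+
      \<comment> \<open>With x frozen, the difference depends on time alone and inherits the period
        T from both solutions.\<close>
      define f where "f s = \<psi> (s, x) - \<phi>T (s, x)" for s
      have "f t = 0"
      proof (rule periodic_decay_imp_zero[OF \<open>T > 0\<close> \<tau> \<xi>])
        fix n
        show "f (t + real n * T) = f t"
          using periodic_add_of_nat_mult[OF \<psi>_per] periodic_add_of_nat_mult[OF \<phi>T_per] p \<open>T > 0\<close>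
          by (simp add: f_def tx(1))
        have s: "t + real n * T \<ge> 0"
          using tx(2) \<open>T > 0\<close> by simp
        \<comment> \<open>At the nonnegative time t + n T, \<open>\<psi>\<close> may be replaced by
          \<open>\<phi>\<close>; the sup norm over [0,L] then bounds the value at x.\<close>
        then have "ereal (infnorm (f (t + real n * T)))
            = ereal (infnorm (\<phi> (t + real n * T, x) - \<phi>T (t + real n * T, x)))"
          using eq tx(3) by (simp add: f_def Dom_def)
        also have "\<dots> \<le> C0_norm {0..L} (\<lambda>x. \<phi> (t + real n * T, x) - \<phi>T (t + real n * T, x))"
          unfolding C0_norm_def by (rule SUP_upper[OF tx(3)])
        also note decay[OF s]
        finally show "infnorm (f (t + real n * T))
            \<le> CS * \<epsilon> * \<xi> ^ nat \<lfloor>(t + real n * T) / T0 \<gamma> \<rho> L \<Psi>\<rfloor>"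
          by (simp only: ereal_less_eq)
      qed
      then show ?thesis
        by (simp add: f_def tx(1))
    qed
    then show "\<exists>\<phi>. periodic_solution \<gamma> \<rho> L T \<kappa>1 \<kappa>2 CE \<epsilon> \<beta> \<phi>1b \<phi>2b \<phi> \<and>
        (\<forall>\<psi>. periodic_solution \<gamma> \<rho> L T \<kappa>1 \<kappa>2 CE \<epsilon> \<beta> \<phi>1b \<phi>2b \<psi> \<longrightarrow>
          (\<forall>p\<in>Dom L. \<psi> p = \<phi> p))"
      using \<phi>T by blast
  qed (use \<epsilon>2 in auto)
qed

end
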